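(* Consider the inverse generalized Fermat-Torricelli problem with respect to $n$ non-overlapping circles $C(A_i,r_i)$, $i=1,\ldots,n$, in $\mathbb{R}^2$ with given generalized Fermat-Torricelli point $P$ (see context), and let $(w_i)_{1\ldots n}$ be its solution weights. The plasticity of the system is expressed by the following equations, satisfied by these weights: $$\Big(\frac{w_2}{w_1}\Big)_{1\ldots n}=\Big(\frac{w_2}{w_1}\Big)_{123}\Big[1-\Big(\frac{w_4}{w_1}\Big)_{1\ldots n}\Big(\frac{w_1}{w_4}\Big)_{134}-\ldots-\Big(\frac{w_n}{w_1}\Big)_{1\ldots n}\Big(\frac{w_1}{w_n}\Big)_{13n}\Big],$$ $$\Big(\frac{w_3}{w_1}\Big)_{1\ldots n}=\Big(\frac{w_3}{w_1}\Big)_{123}\Big[1-\Big(\frac{w_4}{w_1}\Big)_{1\ldots n}\Big(\frac{w_1}{w_4}\Big)_{124}-\ldots-\Big(\frac{w_n}{w_1}\Big)_{1\ldots n}\Big(\frac{w_1}{w_n}\Big)_{12n}\Big].$$ Here $(w_i)_{1\ldots n}$ corresponds to the vertex $A_i$ of the polygon $A_1\ldots A_n$ and $(w_j)_{jkl}$ corresponds to the vertex $A_j$ of $\triangle A_jA_kA_l$, $j,k,l\in\{1,\ldots,n\}$.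
   Context: Setting: the centers $A_1,\ldots,A_n$ are the vertices of a convex $n$-gon in $\mathbb{R}^2$, the circles $C(A_i,r_i)$ (center $A_i$, radius $r_i$) are non-overlapping, and $P$ is a point inside the polygon and outside all the closed disks bounded by the circles. For positive weights $w_i$, the generalized Fermat-Torricelli (F-T) point is the minimizer of $\sum_{i=1}^n w_i\,d(P,C(A_i,r_i))$, $d$ being Euclidean distance. The inverse generalized F-T problem: given $P$, find positive weights $w_i$ with $\sum_i w_i=1$ for which $P$ is the generalized F-T point; solutions are denoted $(w_i)_{1\ldots n}$, and $\big(\frac{w_i}{w_j}\big)_{1\ldots n}=(w_i)_{1\ldots n}/(w_j)_{1\ldots n}$. Triangle ratios: $(w_j)_{jkl},(w_k)_{jkl},(w_l)_{jkl}$ are the weights of the inverse problem with the same point $P$ for $\triangle A_jA_kA_l$; they are determined up to a common factor by $w_j\vec u_j+w_k\vec u_k+w_l\vec u_l=0$, where $\vec u_i$ is the unit vector from $P$ to $A_i$. If $P$ is inside the triangle they are positive and proportional to the sines of the opposite angles at $P$, e.g. $\big(\frac{w_2}{w_1}\big)_{123}=\frac{\sin\angle A_1PA_3}{\sin\angle A_2PA_3}$, $\big(\frac{w_3}{w_1}\big)_{123}=\frac{\sin\angle A_1PA_2}{\sin\angle A_2PA_3}$, $\big(\frac{w_1}{w_i}\big)_{12i}=\frac{\sin\angle A_2PA_i}{\sin\angle A_1PA_2}$; if $P$ is outside the triangle, negative ratios occur, e.g. $\big(\frac{w_1}{w_i}\big)_{13i}=-\frac{\sin\angle A_3PA_i}{\sin\angle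 A_1PA_3}$ when $\vec u_i$ points into the interior of $\angle A_1PA_3$. The ratios that appear are assumed to be defined (nonvanishing denominators). *)

theory Defs
  imports "HOL-Analysis.Analysis"
begin

text \<open>
  Vertices are indexed by \<open>{1..n}\<close> and labelled consecutively along the boundary;
  \<open>i mod n + 1\<close> is the cyclic successor of \<open>i\<close>.  No three vertices are collinear,
  since each of them is an extreme point of the polygon.
\<close>

definition convex_ngon :: "nat \<Rightarrow> (nat \<Rightarrow> real ^ 2) \<Rightarrow> bool" where
  "convex_ngon n A \<longleftrightarrow>
     3 \<le> n \<and> inj_on A {1..n} \<and>
     (\<forall>i\<in>{1..n}. A i extreme_point_of (convex hull (A ` {1..n}))) \<and>
     (\<forall>i\<in>{1..n}. closed_segment (A i) (A (i mod n + 1)) edge_of (convex hull (A ` {1..n})))"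

text \<open>Tangent circles are allowed: only the open disks have to be disjoint.\<close>

definition nonoverlapping_circles :: "nat \<Rightarrow> (nat \<Rightarrow> real ^ 2) \<Rightarrow> (nat \<Rightarrow> real) \<Rightarrow> bool" where
  "nonoverlapping_circles n A r \<longleftrightarrow>
     (\<forall>i\<in>{1..n}. 0 < r i) \<and>
     (\<forall>i\<in>{1..n}. \<forall>j\<in>{1..n}. i \<noteq> j \<longrightarrow> disjnt (ball (A i) (r i)) (ball (A j) (r j)))"

definition ft_objective ::
  "nat \<Rightarrow> (nat \<Rightarrow> real ^ 2) \<Rightarrow> (nat \<Rightarrow> real) \<Rightarrow> (nat \<Rightarrow> real) \<Rightarrow> real ^ 2 \<Rightarrow> real" where
  "ft_objective n A r w X = (\<Sum>i=1..n. w i * infdist X (sphere (A i) (r i)))"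

definition generalized_ft_point ::
  "nat \<Rightarrow> (nat \<Rightarrow> real ^ 2) \<Rightarrow> (nat \<Rightarrow> real) \<Rightarrow> (nat \<Rightarrow> real) \<Rightarrow> real ^ 2 \<Rightarrow> bool" where
  "generalized_ft_point n A r w P \<longleftrightarrow> is_arg_min (ft_objective n A r w) (\<lambda>X. True) P"

definition inverse_ft_solution ::
  "nat \<Rightarrow> (nat \<Rightarrow> real ^ 2) \<Rightarrow> (nat \<Rightarrow> real) \<Rightarrow> real ^ 2 \<Rightarrow> (nat \<Rightarrow> real) \<Rightarrow> bool" where
  "inverse_ft_solution n A r P w \<longleftrightarrow>
     (\<forall>i\<in>{1..n}. 0 < w i) \<and> (\<Sum>i=1..n. w i) = 1 \<and> generalized_ft_point n A r w P"

text \<open>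
  Weights of the triangle with index set \<open>T = {j, k, l}\<close>, relative to \<open>P\<close>; they may be
  negative or zero when \<open>P\<close> is not inside the triangle.  They are determined only up to a
  common nonzero factor, which cancels in the ratios.  Here \<open>sgn (A i - P)\<close> is the unit
  vector from \<open>P\<close> to \<open>A i\<close>.
\<close>

definition triangle_weights ::
  "(nat \<Rightarrow> real ^ 2) \<Rightarrow> real ^ 2 \<Rightarrow> nat set \<Rightarrow> (nat \<Rightarrow> real) \<Rightarrow> bool" where
  "triangle_weights A P T v \<longleftrightarrow>
     (\<exists>i\<in>T. v i \<noteq> 0) \<and> (\<Sum>i\<in>T. v i *\<^sub>R sgn (A i - P)) = 0"

end

theory Submission
  imports Defs
begin

text \<open>
  Near \<open>P\<close> each distance to a circle is the distance to its center minus the radius, so the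
  first-order condition at the minimizer is \<open>\<Sum>i. w i *\<^sub>R sgn (A i - P) = 0\<close>.  Taking inner products
  with a vector orthogonal to \<open>sgn (A 3 - P)\<close> removes vertex 3 from this relation and from the
  relations of the triangles \<open>{1, 2, 3}\<close> and \<open>{1, 3, i}\<close>; what remains is linear in the
  components, and eliminating them yields the first equation.  Removing vertex 2
  instead yields the second.  The elimination could only fail if all centers lay on one line
  through \<open>P\<close>, which is impossible for a point in the interior of the polygon.
\<close>

text \<open>The triangle inequality bounds the distance to every point of the sphere from below, and
  the radial projection of \<open>x\<close> attains the bound.\<close>

lemma infdist_sphere_outside:
  fixes a x :: "'a :: real_normed_vector"
  assumes "0 \<le> r" "r \<le> dist x a"
  shows "infdist x (sphere a r) = dist x a - r"
proof (cases "x = a")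
  case True
  \<comment> \<open>Here \<open>r = 0\<close>, so the sphere is the single point
    \<open>x\<close>.\<close>
  with assms show ?thesis by simp
next
  case False
  define y where "y = a + (r / dist x a) *\<^sub>R (x - a)"
  have d: "dist x a > 0" using False by simp
  have y: "y \<in> sphere a r"
    using assms d by (simp add: y_def dist_norm)
  have "x - y = (1 - r / dist x a) *\<^sub>R (x - a)"
    by (simp add: y_def algebra_simps)
  then have "dist x y = \<bar>1 - r / dist x a\<bar> * dist x a"
    by (simp add: dist_norm)
  also have "\<dots> = dist x a - r"
    using assms d by (simp add: field_simps)
  finally have "infdist x (sphere a r) \<le> dist x a - r"
    using infdist_le[OF y, of x] by simp
  moreover have "dist x a - r \<le> infdist x (sphere a r)"
  proof -
    have ne: "sphere a r \<noteq> {}" using y by blast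
    have "dist x a - r \<le> dist x z" if "z \<in> sphere a r" for z
      using that dist_triangle[of x a z] by (simp add: dist_commute)
    then show ?thesis
      unfolding infdist_notempty[OF ne] by (intro cINF_greatest[OF ne])
  qed
  ultimately show ?thesis by simp
qed

lemma generalized_ft_point_balance:
  assumes "\<And>i. i \<in> {1..n} \<Longrightarrow> 0 < r i"
    and outside: "\<And>i. i \<in> {1..n} \<Longrightarrow> P \<notin> cball (A i) (r i)"
    and ft: "generalized_ft_point n A r w P"
  shows "(\<Sum>i=1..n. w i *\<^sub>R sgn (A i - P)) = 0"
proof -
  \<comment> \<open>On the open set \<open>S\<close> the objective equals \<open>g\<close>, which is
    differentiable at \<open>P\<close>; a global minimizer of the objective in \<open>S\<close>
    therefore minimizes \<open>g\<close> on \<open>S\<close>.\<close>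
  define S where "S = (\<Inter>i\<in>{1..n}. - cball (A i) (r i))"
  define g where "g X = (\<Sum>i=1..n. w i * (norm (X - A i) - r i))" for X
  have "open S" unfolding S_def by (intro open_INT) auto
  have "P \<in> S" using outside by (auto simp: S_def)
  have g: "ft_objective n A r w X = g X" if "X \<in> S" for X
    unfolding ft_objective_def g_def
  proof (intro sum.cong refl)
    fix i assume i: "i \<in> {1..n}"
    then have "X \<notin> cball (A i) (r i)" using that unfolding S_def by blast
    then have "r i \<le> dist X (A i)" by (simp add: dist_commute)
    then show "w i * infdist X (sphere (A i) (r i)) = w i * (norm (X - A i) - r i)"
      using infdist_sphere_outside[of "r i" X "A i"] assms(1)[OF i] by (simp add: dist_norm)
  qed
  have "g P \<le> g X" if "X \<in> S" for X
    using ft g[OF that] g[OF \<open>P \<in> S\<close>]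
    unfolding generalized_ft_point_def is_arg_min_linorder by metis
  moreover have "(g has_derivative (\<lambda>h. (\<Sum>i=1..n. w i *\<^sub>R sgn (P - A i)) \<bullet> h)) (at P)"
  proof -
    have "((\<lambda>X. w i * (norm (X - A i) - r i)) has_derivative (\<lambda>h. w i * (h \<bullet> sgn (P - A i)))) (at P)"
      if i: "i \<in> {1..n}" for i
    proof -
      \<comment> \<open>Positive radii keep \<open>P\<close> away from the centers, where the norm
        is not differentiable.\<close>
      have "P - A i \<noteq> 0" using outside[OF i] assms(1)[OF i] by auto
      then have "((\<lambda>X. norm (X - A i)) has_derivative (\<lambda>h. h \<bullet> sgn (P - A i))) (at P)"
        by (intro has_derivative_compose[OF _ has_derivative_norm])
          (auto intro!: derivative_eq_intros)
      then show ?thesis by (auto intro!: derivative_eq_intros)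
    qed
    then have "(g has_derivative (\<lambda>h. \<Sum>i=1..n. w i * (h \<bullet> sgn (P - A i)))) (at P)"
      unfolding g_def by (rule has_derivative_sum)
    then show ?thesis by (simp add: inner_sum_right inner_commute)
  qed
  ultimately have "(\<lambda>h. (\<Sum>i=1..n. w i *\<^sub>R sgn (P - A i)) \<bullet> h) = (\<lambda>h. 0)"
    using differential_zero_maxmin[OF \<open>P \<in> S\<close> \<open>open S\<close>] by blast
  \<comment> \<open>Evaluate the zero functional at the vector representing it.\<close>
  then have "(\<Sum>i=1..n. w i *\<^sub>R sgn (P - A i)) = 0"
    by (metis inner_eq_zero_iff)
  moreover have "sgn (A i - P) = - sgn (P - A i)" for i
    using sgn_minus[of "P - A i"] by simp
  ultimately show ?thesis by (simp add: sum_negf)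
qed

text \<open>Otherwise the hull would lie in the hyperplane through \<open>P\<close> with normal
  \<open>z\<close>, which has empty interior.\<close>

lemma interior_hull_not_on_line:
  fixes P z :: "'a :: euclidean_space"
  assumes "P \<in> interior (convex hull (A ` I))" and "z \<noteq> 0"
  obtains i where "i \<in> I" "sgn (A i - P) \<bullet> z \<noteq> 0"
proof -
  have "\<exists>i\<in>I. sgn (A i - P) \<bullet> z \<noteq> 0"
  proof (rule ccontr)
    assume "\<not> (\<exists>i\<in>I. sgn (A i - P) \<bullet> z \<noteq> 0)"
    \<comment> \<open>A vertex equal to \<open>P\<close> has \<open>sgn 0 = 0\<close>, but it lies
      on the hyperplane as well.\<close>
    then have "A ` I \<subseteq> {x. z \<bullet> x = z \<bullet> P}"
      by (auto simp: sgn_div_norm inner_diff inner_commute)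
    then have "convex hull (A ` I) \<subseteq> {x. z \<bullet> x = z \<bullet> P}"
      by (intro hull_minimal convex_hyperplane)
    then have "P \<in> interior {x. z \<bullet> x = z \<bullet> P}"
      using assms(1) interior_mono by blast
    then show False using assms(2) by simp
  qed
  then show thesis using that by blast
qed

text \<open>Scalar core of both equations: \<open>q\<close> holds components along a fixed
  direction, \<open>s, t\<close> are the weights in the base triangle and \<open>a i, b i\<close>
  those in the side triangles. Every component is a multiple of \<open>q k\<close>, which can then
  be cancelled.\<close>

lemma weight_ratio_elimination:
  fixes q w :: "'i \<Rightarrow> 'f :: field"
  assumes balance: "w j * q j + w k * q k + (\<Sum>i\<in>I. w i * q i) = 0"
    and base: "s * q j + t * q k = 0" "s \<noteq> 0"
    and side: "\<And>i. i \<in> I \<Longrightarrow> a i * q j + b i * q i = 0" "\<And>i. i \<in> I \<Longrightarrow> b i \<noteq> 0"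
    and "w j \<noteq> 0"
    and nontrivial: "\<exists>i \<in> insert j (insert k I). q i \<noteq> 0"
  shows "w k / w j = t / s * (1 - (\<Sum>i\<in>I. w i / w j * (a i / b i)))"
proof -
  have qi: "q i = - (a i / b i) * q j" if "i \<in> I" for i
    using side[OF that] by (simp add: field_simps eq_neg_iff_add_eq_0 add.commute)
  have qj: "q j = - (t / s) * q k"
    using base by (simp add: field_simps eq_neg_iff_add_eq_0)
  \<comment> \<open>If \<open>q k\<close> vanished, so would \<open>q j\<close> and with it every
    \<open>q i\<close>.\<close>
  then have "q k \<noteq> 0" using nontrivial qi by auto
  have "(\<Sum>i\<in>I. w i * q i) = - w j * q j * (\<Sum>i\<in>I. w i / w j * (a i / b i))"
    unfolding sum_distrib_left using qi \<open>w j \<noteq> 0\<close> by (intro sum.cong) auto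
  then have "w k * q k = - q j * w j * (1 - (\<Sum>i\<in>I. w i / w j * (a i / b i)))"
    using balance by algebra
  also have "\<dots> = q k * (w j * (t / s * (1 - (\<Sum>i\<in>I. w i / w j * (a i / b i)))))"
    unfolding qj by simp
  finally have "w k = w j * (t / s * (1 - (\<Sum>i\<in>I. w i / w j * (a i / b i))))"
    using \<open>q k \<noteq> 0\<close> by (metis mult.commute mult_left_cancel)
  then show ?thesis using \<open>w j \<noteq> 0\<close> by (metis nonzero_mult_div_cancel_left)
qed

lemma triangle_weights_inner:
  assumes "triangle_weights A P {j, k, l} v" and "card {j, k, l} = 3"
    and "sgn (A l - P) \<bullet> z = 0"
  shows "v j * (sgn (A j - P) \<bullet> z) + v k * (sgn (A k - P) \<bullet> z) = 0"
proof -
  \<comment> \<open>Distinctness lets the sum over the set split into three separate terms.\<close>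
  have "j \<noteq> k" "j \<noteq> l" "k \<noteq> l"
    using assms(2) by (auto simp: card_insert_if split: if_splits)
  then have "v j *\<^sub>R sgn (A j - P) + v k *\<^sub>R sgn (A k - P) + v l *\<^sub>R sgn (A l - P) = 0"
    using assms(1) by (simp add: triangle_weights_def add.assoc)
  then have "(v j *\<^sub>R sgn (A j - P) + v k *\<^sub>R sgn (A k - P) + v l *\<^sub>R sgn (A l - P)) \<bullet> z = 0"
    by simp
  then show ?thesis using assms(3) by (simp add: inner_add_left)
qed

text \<open>The two equations differ only by exchanging vertices 2 and 3, so both are treated at
  once: \<open>k\<close> is the vertex whose ratio is sought, \<open>l\<close> the one
  eliminated.\<close>

lemma weight_ratio_from_triangles:
  fixes A :: "nat \<Rightarrow> real ^ 2"
  assumes balance: "(\<Sum>i=1..n. w i *\<^sub>R sgn (A i - P)) = 0"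
    and inside: "P \<in> interior (convex hull (A ` {1..n}))"
    and "3 \<le> n" and kl: "{k, l} = {2, 3}"
    and tri: "\<And>T. T \<subseteq> {1..n} \<Longrightarrow> card T = 3 \<Longrightarrow> triangle_weights A P T (W T)"
    and base: "W {1, 2, 3} 1 \<noteq> 0"
    and side: "\<And>i. i \<in> {4..n} \<Longrightarrow> W {1, l, i} i \<noteq> 0"
    and "w 1 \<noteq> 0"
  shows "w k / w 1 = W {1, 2, 3} k / W {1, 2, 3} 1 *
           (1 - (\<Sum>i=4..n. w i / w 1 * (W {1, l, i} 1 / W {1, l, i} i)))"
proof -
  \<comment> \<open>A nonzero normal to one vector exists because the dimension is 2.\<close>
  obtain z where "z \<noteq> 0" and z: "sgn (A l - P) \<bullet> z = 0"
    using orthogonal_to_vector_exists[of "sgn (A l - P)"] by (auto simp: orthogonal_def)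
  define q where "q i = sgn (A i - P) \<bullet> z" for i
  have ql: "q l = 0" using z by (simp add: q_def)
  have kl': "k = 2 \<and> l = 3 \<or> k = 3 \<and> l = 2" using kl by (auto simp: doubleton_eq_iff)
  have split: "{1..n} = insert 1 (insert k (insert l {4..n}))"
    using \<open>3 \<le> n\<close> kl' by auto
  have T: "{1, 2, 3} = {1, k, l}" using kl by auto
  show ?thesis
  proof (rule weight_ratio_elimination[where q = q])
    have "(\<Sum>i=1..n. w i * q i) = 0"
      using arg_cong[OF balance, of "\<lambda>x. x \<bullet> z"] by (simp add: inner_sum_left q_def)
    then show "w 1 * q 1 + w k * q k + (\<Sum>i=4..n. w i * q i) = 0"
      unfolding split using kl' ql by auto
    show "W {1, 2, 3} 1 * q 1 + W {1, 2, 3} k * q k = 0"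
      unfolding q_def T
      by (rule triangle_weights_inner[OF tri _ z]) (use \<open>3 \<le> n\<close> kl' in auto)
    show "W {1, l, i} 1 * q 1 + W {1, l, i} i * q i = 0" if "i \<in> {4..n}" for i
    proof -
      \<comment> \<open>Reordering puts the eliminated vertex last, as
        \<open>triangle_weights_inner\<close> expects.\<close>
      have "{1, l, i} = {1, i, l}" by auto
      then show ?thesis
        unfolding q_def
        by (simp only:, intro triangle_weights_inner[OF tri _ z]) (use that kl' in auto)
    qed
    obtain i where "i \<in> {1..n}" "q i \<noteq> 0"
      using interior_hull_not_on_line[OF inside \<open>z \<noteq> 0\<close>] unfolding q_def by blast
    \<comment> \<open>The index found cannot be \<open>l\<close>, since
      \<open>q l = 0\<close>.\<close>
    then show "\<exists>i \<in> insert 1 (insert k {4..n}). q i \<noteq> 0"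
      unfolding split using ql by auto
  qed (use base side \<open>w 1 \<noteq> 0\<close> in auto)
qed

theorem proposition3:
  fixes n :: nat
    and A :: "nat \<Rightarrow> real ^ 2"
    and r :: "nat \<Rightarrow> real"
    and P :: "real ^ 2"
    and w :: "nat \<Rightarrow> real"
    and W :: "nat set \<Rightarrow> nat \<Rightarrow> real"
  assumes polygon: "convex_ngon n A"
    and circles: "nonoverlapping_circles n A r"
    and P_inside: "P \<in> interior (convex hull (A ` {1..n}))"
    and P_outside: "\<And>i. i \<in> {1..n} \<Longrightarrow> P \<notin> cball (A i) (r i)"
    and solution: "inverse_ft_solution n A r P w"
    and triangles: "\<And>T. T \<subseteq> {1..n} \<Longrightarrow> card T = 3 \<Longrightarrow> triangle_weights A P T (W T)"
    and defined_123: "W {1, 2, 3} 1 \<noteq> 0"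
    and defined_13i: "\<And>i. i \<in> {4..n} \<Longrightarrow> W {1, 3, i} i \<noteq> 0"
    and defined_12i: "\<And>i. i \<in> {4..n} \<Longrightarrow> W {1, 2, i} i \<noteq> 0"
  shows "w 2 / w 1 = W {1, 2, 3} 2 / W {1, 2, 3} 1 *
           (1 - (\<Sum>i=4..n. w i / w 1 * (W {1, 3, i} 1 / W {1, 3, i} i)))
       \<and> w 3 / w 1 = W {1, 2, 3} 3 / W {1, 2, 3} 1 *
           (1 - (\<Sum>i=4..n. w i / w 1 * (W {1, 2, i} 1 / W {1, 2, i} i)))"
proof -
  have "3 \<le> n" using polygon by (simp add: convex_ngon_def)
  have "w 1 \<noteq> 0"
    using solution \<open>3 \<le> n\<close> by (force simp: inverse_ft_solution_def)
  have "(\<Sum>i=1..n. w i *\<^sub>R sgn (A i - P)) = 0"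
    using circles P_outside solution
    by (intro generalized_ft_point_balance[where r = r])
      (auto simp: nonoverlapping_circles_def inverse_ft_solution_def)
  note ratio = weight_ratio_from_triangles[OF this P_inside \<open>3 \<le> n\<close> _ triangles defined_123 _ \<open>w 1 \<noteq> 0\<close>]
  have "{3, 2} = {2, 3 :: nat}" by auto
  with ratio[of 2 3] ratio[of 3 2] defined_13i defined_12i show ?thesis by blast
qed

end
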